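(* Let $f:\mathbb{R}\to\mathbb{R}$ satisfy the basic conditions (B1)--(B6) listed in the context, let $A=\{(t,f(t)):t\in\mathbb{R}\}$ and $B=\mathbb{R}\times\{0\}$, and suppose $f''(t)<0$ for $t\in(0,\epsilon_3]$. For $\mathbf{x}=(x,0)$ write $\mathbf{x}_+=C_T\mathbf{x}$. Then for any $K>0$ there exists $\epsilon_{K_f}>0$ such that $$x\in(0,\epsilon_{K_f}]\ \Longrightarrow\ \frac{\|\mathbf{x}_+\|}{\|\mathbf{x}\|}\le\frac1K.$$
   Context: For closed nonempty $S\subset\mathbb{R}^2$, $P_S$ is a fixed selector ($P_S\mathbf{x}\in\mathbb{P}_S\mathbf{x}$) of $\mathbb{P}_S\mathbf{x}=\{\mathbf{z}\in S:\|\mathbf{x}-\mathbf{z}\|=\inf_{\mathbf{v}\in S}\|\mathbf{x}-\mathbf{v}\|\}$; $R_S=2P_S-\mathrm{Id}$; $T_{A,B}=\frac12R_BR_A+\frac12\mathrm{Id}$. The circumcenter $C(\mathbf{u},\mathbf{v},\mathbf{w})$ is the point of the affine hull of $\{\mathbf{u},\mathbf{v},\mathbf{w}\}$ equidistant from $\mathbf{u},\mathbf{v},\mathbf{w}$, and $\mathrm{CRM}(\mathbf{x})=C(\mathbf{x},R_A\mathbf{x},R_BR_A\mathbf{x})$. Three points are colinear if they lie on a common line (in particular if two of them coincide). $C_T\mathbf{x}=T_{A,B}\mathbf{x}$ if $\mathbf{x},R_A\mathbf{x},R_BR_A\mathbf{x}$ are colinear, and $C_T\mathbf{x}=\mathrm{CRM}(\mathbf{x})$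 otherwise. Basic conditions on $f$: (B1) $f$ is continuous and $\mathbf{0}=(0,0)$ is an isolated point of $A\cap B$ (in particular $f(0)=0$); (B2) there is $\epsilon_1>0$ such that $0$ is the only root of $f$ on $[-\epsilon_1,\epsilon_1]$; (B3) $f$ is continuous on $[-\epsilon_1,\epsilon_1]$ and differentiable on $[-\epsilon_1,\epsilon_1]\setminus\{0\}$; (B4) there is $\epsilon_2>0$ such that $f$ is differentiable with $f'(t)\ne0$ for all $t\in[-\epsilon_2,\epsilon_2]\setminus\{0\}$; (B5) there is $\epsilon_3>0$ such that $f'$ is continuous and differentiable on $[-\epsilon_3,\epsilon_3]\setminus\{0\}$ with $f''(t)\neq0$ there; (B6) $f$ is positive on $(0,\epsilon_1]$. *)

theory Defs
  imports "HOL-Analysis.Analysis"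
begin

text \<open>The plane is \<^typ>\<open>real \<times> real\<close>; its library norm is the Euclidean one.\<close>

definition proj_set :: "(real \<times> real) set \<Rightarrow> real \<times> real \<Rightarrow> (real \<times> real) set" where
  "proj_set S x = {z \<in> S. norm (x - z) = (INF v\<in>S. norm (x - v))}"

definition proj_selector :: "((real \<times> real) set \<Rightarrow> real \<times> real \<Rightarrow> real \<times> real) \<Rightarrow> bool" where
  "proj_selector P \<longleftrightarrow> (\<forall>S x. closed S \<and> S \<noteq> {} \<longrightarrow> P S x \<in> proj_set S x)"

text \<open>The operators below take the selector \<open>P\<close> as their first argument.\<close>

definition reflection ::
    "((real \<times> real) set \<Rightarrow> real \<times> real \<Rightarrow> real \<times> real) \<Rightarrow> (real \<times> real) set
      \<Rightarrow> real \<times> real \<Rightarrow> real \<times> real" where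
  "reflection P S x = 2 *\<^sub>R P S x - x"

definition DR_op ::
    "((real \<times> real) set \<Rightarrow> real \<times> real \<Rightarrow> real \<times> real) \<Rightarrow> (real \<times> real) set
      \<Rightarrow> (real \<times> real) set \<Rightarrow> real \<times> real \<Rightarrow> real \<times> real" where
  "DR_op P A B x = (1/2) *\<^sub>R reflection P B (reflection P A x) + (1/2) *\<^sub>R x"

text \<open>Well defined when the three points are not collinear, the only case in which
  \<open>C_T\<close> below uses it.\<close>

definition circumcenter ::
    "real \<times> real \<Rightarrow> real \<times> real \<Rightarrow> real \<times> real \<Rightarrow> real \<times> real" where
  "circumcenter u v w =
    (THE c. c \<in> affine hull {u, v, w} \<and> dist c u = dist c v \<and> dist c v = dist c w)"

definition CRM ::
    "((real \<times> real) set \<Rightarrow> real \<times> real \<Rightarrow> real \<times> real) \<Rightarrow> (real \<times> real) set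
      \<Rightarrow> (real \<times> real) set \<Rightarrow> real \<times> real \<Rightarrow> real \<times> real" where
  "CRM P A B x =
    circumcenter x (reflection P A x) (reflection P B (reflection P A x))"

definition C_T ::
    "((real \<times> real) set \<Rightarrow> real \<times> real \<Rightarrow> real \<times> real) \<Rightarrow> (real \<times> real) set
      \<Rightarrow> (real \<times> real) set \<Rightarrow> real \<times> real \<Rightarrow> real \<times> real" where
  "C_T P A B x =
    (if collinear {x, reflection P A x, reflection P B (reflection P A x)}
     then DR_op P A B x else CRM P A B x)"

definition graph_of :: "(real \<Rightarrow> real) \<Rightarrow> (real \<times> real) set" where
  "graph_of f = {(t, f t) | t. t \<in> UNIV}"

definition x_axis :: "(real \<times> real) set" where
  "x_axis = UNIV \<times> {0}"

text \<open>Derivatives are the usual two-sided ones, also at the endpoints of the intervals.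
  The differentiability of \<open>f\<close> in \<open>B5\<close> is what makes \<open>deriv f\<close> meaningful there.\<close>

locale basic_conditions =
  fixes f :: "real \<Rightarrow> real" and \<epsilon>1 \<epsilon>2 \<epsilon>3 :: real
  assumes eps_pos: "\<epsilon>1 > 0" "\<epsilon>2 > 0" "\<epsilon>3 > 0"
    and B1: "continuous_on UNIV f" "(0, 0) isolated_in (graph_of f \<inter> x_axis)"
    and B2: "\<forall>t\<in>{-\<epsilon>1..\<epsilon>1}. f t = 0 \<longleftrightarrow> t = 0"
    and B3: "continuous_on {-\<epsilon>1..\<epsilon>1} f"
      "\<forall>t\<in>{-\<epsilon>1..\<epsilon>1} - {0}. f differentiable (at t)"
    and B4: "\<forall>t\<in>{-\<epsilon>2..\<epsilon>2} - {0}. f differentiable (at t) \<and> deriv f t \<noteq> 0"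
    and B5: "\<forall>t\<in>{-\<epsilon>3..\<epsilon>3} - {0}. f differentiable (at t)"
      "continuous_on ({-\<epsilon>3..\<epsilon>3} - {0}) (deriv f)"
      "\<forall>t\<in>{-\<epsilon>3..\<epsilon>3} - {0}.
         deriv f differentiable (at t) \<and> deriv (deriv f) t \<noteq> 0"
    and B6: "\<forall>t\<in>{0<..\<epsilon>1}. f t > 0"

end

theory Submission
  imports Defs
begin

text \<open>
  One step of the operator from \<open>(x, 0)\<close> is a Newton step for \<open>f\<close>, taken at the abscissa
  of the projection instead of at \<open>x\<close>. Let \<open>(t, f t)\<close> be the projection of \<open>(x, 0)\<close> on
  the graph. The two reflected points are \<open>(2t - x, 2 f t)\<close> and its mirror image in the axis,
  so their circumcenter with \<open>(x, 0)\<close> lies on the axis, at abscissa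
  \<open>t - (f t)\<^sup>2 / (x - t)\<close> (\<open>circumcenter_mirror_pair\<close>). Since \<open>t\<close> minimises
  \<open>(x - s)\<^sup>2 + (f s)\<^sup>2\<close>, it satisfies \<open>x - t = f t * f' t\<close>, and the abscissa becomes
  \<open>t - f t / f' t\<close>. A projection with \<open>t = 0\<close> sends \<open>(x, 0)\<close> to the origin at once.

  Concavity and positivity force \<open>f' > 0\<close> near \<open>0\<close> on the right, and \<open>f t \<ge> t * f' t\<close>. The
  claim is therefore that \<open>f t / f' t - t\<close> is at most \<open>1 / K\<close> times \<open>x = t + f t * f' t\<close>.
  As \<open>f'\<close> decreases, there are two possibilities at \<open>0\<close>. If \<open>(f')\<^sup>2\<close> reaches \<open>K\<close>, it is
  at least \<open>K\<close> from there down to \<open>0\<close>, and the quotient \<open>1 / (f' t)\<^sup>2\<close> of \<open>f t / f' t\<close> by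
  \<open>f t * f' t\<close> is at most \<open>1 / K\<close>. Otherwise \<open>f'\<close> is bounded and has a positive limit \<open>L\<close>
  at \<open>0\<close>, and \<open>f t / f' t \<le> t * L / f' t\<close> exceeds \<open>t\<close> by a small multiple of \<open>t\<close>
  (\<open>newton_error_concave\<close>).
\<close>

section \<open>Projections and reflections\<close>

lemma proj_set_norm_le:
  assumes "z \<in> proj_set S x" "v \<in> S"
  shows "norm (x - z) \<le> norm (x - v)"
proof -
  have "(INF v\<in>S. norm (x - v)) \<le> norm (x - v)"
    by (rule cINF_lower) (auto intro: bdd_belowI[of _ 0] assms)
  then show ?thesis using assms(1) by (simp add: proj_set_def)
qed

lemma closed_graph_of:
  assumes "continuous_on UNIV f"
  shows "closed (graph_of f)"
proof -
  have "graph_of f = {p. snd p = f (fst p)}" by (auto simp: graph_of_def)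
  moreover have "closed {p. snd p = f (fst p)}"
    by (intro closed_Collect_eq continuous_intros continuous_on_compose2[OF assms]) auto
  ultimately show ?thesis by simp
qed

lemma reflection_x_axis:
  assumes "proj_selector P"
  shows "reflection P x_axis (a, b) = (a, - b)"
proof -
  have "closed x_axis" "x_axis \<noteq> {}" by (auto simp: x_axis_def intro: closed_Times)
  then have z: "P x_axis (a, b) \<in> proj_set x_axis (a, b)"
    using assms by (auto simp: proj_selector_def)
  then obtain c where c: "P x_axis (a, b) = (c, 0)"
    by (auto simp: proj_set_def x_axis_def)
  have "norm ((a, b) - (c, 0)) \<le> norm ((a, b) - (a, 0))"
    using proj_set_norm_le[OF z, of "(a, 0)"] c by (auto simp: x_axis_def)
  then have "sqrt ((a - c)\<^sup>2 + b\<^sup>2) \<le> \<bar>b\<bar>" by (simp add: norm_Pair)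
  then have "c = a" by (auto dest: sqrt_le_D)
  with c show ?thesis by (simp add: reflection_def)
qed

section \<open>The operator on the axis\<close>

text \<open>The pair is mirrored in the axis, so equidistance from it puts the center on the axis;
  equidistance from \<open>(x, 0)\<close> is then a linear equation for the abscissa.\<close>

lemma circumcenter_mirror_pair:
  fixes x t y :: real
  assumes "y \<noteq> 0" "t \<noteq> x"
  shows "circumcenter (x, 0) (2 * t - x, 2 * y) (2 * t - x, - (2 * y)) = (t - y\<^sup>2 / (x - t), 0)"
  unfolding circumcenter_def
proof (rule the_equality, intro conjI)
  define c where "c = t - y\<^sup>2 / (x - t)"
  have ceq: "(c - t) * (x - t) = - y\<^sup>2" using assms by (simp add: c_def)
  \<comment> \<open>\<open>u\<close> is the affine coordinate of the center on the line through \<open>(x, 0)\<close> (at \<open>0\<close>) and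
     the midpoint \<open>(2t - x, 0)\<close> of the mirrored pair (at \<open>1\<close>).\<close>
  define u where "u = (x - c) / (2 * (x - t))"
  have "x - 2 * (x - t) * u = c" using assms by (simp add: u_def)
  then have "(c, 0) = (1 - u) *\<^sub>R (x, 0) + (u / 2) *\<^sub>R (2 * t - x, 2 * y)
      + (u / 2) *\<^sub>R (2 * t - x, - (2 * y))"
    by (simp add: algebra_simps)
  moreover have "(1 - u) + u / 2 + u / 2 = 1" by simp
  ultimately have "(c, 0) \<in> affine hull {(x, 0), (2 * t - x, 2 * y), (2 * t - x, - (2 * y))}"
    unfolding affine_hull_3 by blast
  then show "(t - y\<^sup>2 / (x - t), 0)
      \<in> affine hull {(x, 0), (2 * t - x, 2 * y), (2 * t - x, - (2 * y))}"
    by (simp add: c_def)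
  have "(c - x)\<^sup>2 = (c - (2 * t - x))\<^sup>2 + (2 * y)\<^sup>2"
    using ceq by (simp add: power2_eq_square algebra_simps)
  then show "dist (t - y\<^sup>2 / (x - t), 0) (x, 0) = dist (t - y\<^sup>2 / (x - t), 0) (2 * t - x, 2 * y)"
    by (simp add: dist_Pair_Pair dist_real_def c_def[symmetric])
  show "dist (t - y\<^sup>2 / (x - t), 0) (2 * t - x, 2 * y)
      = dist (t - y\<^sup>2 / (x - t), 0) (2 * t - x, - (2 * y))"
    by (simp add: dist_Pair_Pair dist_real_def)
next
  fix p :: "real \<times> real"
  assume p: "p \<in> affine hull {(x, 0), (2 * t - x, 2 * y), (2 * t - x, - (2 * y))} \<and>
    dist p (x, 0) = dist p (2 * t - x, 2 * y) \<and>
    dist p (2 * t - x, 2 * y) = dist p (2 * t - x, - (2 * y))"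
  obtain a b where ab: "p = (a, b)" by (cases p)
  have "(b - 2 * y)\<^sup>2 = (b + 2 * y)\<^sup>2"
    using p by (simp add: ab dist_Pair_Pair dist_real_def)
  then have "b * y = 0" by (simp add: power2_eq_square algebra_simps)
  then have b: "b = 0" using assms by simp
  have "sqrt ((a - x)\<^sup>2) = sqrt ((a - (2 * t - x))\<^sup>2 + (2 * y)\<^sup>2)"
    using p by (simp add: ab b dist_Pair_Pair dist_real_def)
  then have "(a - x)\<^sup>2 = (a - (2 * t - x))\<^sup>2 + (2 * y)\<^sup>2" by (simp only: real_sqrt_eq_iff)
  then have "(a - t) * (x - t) = - y\<^sup>2" by (simp add: power2_eq_square algebra_simps)
  then have "a = t - y\<^sup>2 / (x - t)" using assms by (simp add: field_simps)
  with b ab show "p = (t - y\<^sup>2 / (x - t), 0)" by simp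
qed

lemma not_collinear_mirror_pair:
  fixes x a b :: real
  assumes "b \<noteq> 0" "a \<noteq> x"
  shows "\<not> collinear {(x, 0), (a, b), (a, - b)}"
proof
  assume "collinear {(x, 0), (a, b), (a, - b)}"
  then obtain u where u: "\<forall>p\<in>{(x, 0), (a, b), (a, - b)}. \<forall>q\<in>{(x, 0), (a, b), (a, - b)}.
      \<exists>c. p - q = c *\<^sub>R u"
    unfolding collinear_def by blast
  then obtain c d where c: "(a, b) - (a, - b) = c *\<^sub>R u" and d: "(x, 0) - (a, b) = d *\<^sub>R u"
    by blast
  have "c * fst u = 0" "c * snd u = 2 * b" using arg_cong[OF c, of fst] arg_cong[OF c, of snd]
    by simp_all
  then have "fst u = 0" using assms by auto
  then show False using arg_cong[OF d, of fst] assms by simp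
qed

lemma C_T_axis_eq_0:
  assumes "proj_selector P" "P A (x, 0) = (0, 0)"
  shows "C_T P A x_axis (x, 0) = 0"
proof -
  have "reflection P A (x, 0) = (- x, 0)" using assms(2) by (simp add: reflection_def)
  then show ?thesis
    by (simp add: C_T_def DR_op_def reflection_x_axis[OF assms(1)] zero_prod_def)
qed

lemma C_T_axis:
  assumes "proj_selector P" "P A (x, 0) = (t, y)" "y \<noteq> 0" "t \<noteq> x"
  shows "C_T P A x_axis (x, 0) = (t - y\<^sup>2 / (x - t), 0)"
proof -
  have R: "reflection P A (x, 0) = (2 * t - x, 2 * y)" using assms(2) by (simp add: reflection_def)
  have "\<not> collinear {(x, 0), (2 * t - x, 2 * y), (2 * t - x, - (2 * y))}"
    using assms by (intro not_collinear_mirror_pair) auto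
  then show ?thesis
    using assms by (simp add: C_T_def CRM_def R reflection_x_axis circumcenter_mirror_pair)
qed

section \<open>Nearest points of a graph\<close>

lemma proj_graph_critical:
  assumes "(t, f t) \<in> proj_set (graph_of f) (x, 0)" "(f has_real_derivative D) (at t)"
  shows "x - t = f t * D"
proof -
  let ?g = "\<lambda>s. (x - s)\<^sup>2 + (f s)\<^sup>2"
  have "?g t \<le> ?g s" for s
    using proj_set_norm_le[OF assms(1), of "(s, f s)"] by (auto simp: graph_of_def norm_Pair)
  moreover have "(?g has_real_derivative - 2 * (x - t) + 2 * (f t * D)) (at t)"
    by (auto intro!: derivative_eq_intros assms(2))
  ultimately have "- 2 * (x - t) + 2 * (f t * D) = 0"
    by (intro DERIV_local_min[of ?g _ t 1]) auto
  then show ?thesis by simp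
qed

text \<open>The origin belongs to the graph, so the projection lies in the disc of radius \<open>x\<close>
  about \<open>(x, 0)\<close>; this keeps it out of the left half plane, where \<open>f\<close> can take either sign.\<close>

lemma proj_graph_range:
  assumes "(t, f t) \<in> proj_set (graph_of f) (x, 0)" "f 0 = 0" "x > 0"
  shows "0 \<le> t" "t \<le> 2 * x"
proof -
  have "norm ((x, 0) - (t, f t)) \<le> norm ((x, 0) - (0, f 0))"
    by (rule proj_set_norm_le[OF assms(1)]) (auto simp: graph_of_def)
  then have "(x - t)\<^sup>2 + (f t)\<^sup>2 \<le> x\<^sup>2" using assms by (auto simp: norm_Pair intro: sqrt_le_D)
  then have "(x - t)\<^sup>2 \<le> x\<^sup>2" using zero_le_power2[of "f t"] by linarith
  then have "\<bar>x - t\<bar> \<le> x" using assms(3) abs_le_square_iff[of "x - t" x] by simp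
  then show "0 \<le> t" "t \<le> 2 * x" by auto
qed

section \<open>Newton steps for concave functions\<close>

text \<open>The right-hand side \<open>t + f t * f' t\<close> is the abscissa whose projection is \<open>(t, f t)\<close>.\<close>

lemma newton_error_concave:
  fixes f f' :: "real \<Rightarrow> real" and \<delta> K :: real
  assumes "\<delta> > 0" "K > 0" "f 0 = 0" "continuous_on {0..\<delta>} f"
    and der: "\<And>t. t \<in> {0<..\<delta>} \<Longrightarrow> (f has_real_derivative f' t) (at t)"
    and dec: "\<And>s t. 0 < s \<Longrightarrow> s \<le> t \<Longrightarrow> t \<le> \<delta> \<Longrightarrow> f' t \<le> f' s"
    and pos: "\<And>t. t \<in> {0<..\<delta>} \<Longrightarrow> f t > 0"
  obtains \<eta> where "0 < \<eta>" "\<eta> \<le> \<delta>"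
    "\<And>t. t \<in> {0<..\<eta>} \<Longrightarrow> f' t > 0"
    "\<And>t. t \<in> {0<..\<eta>} \<Longrightarrow> \<bar>t - f t / f' t\<bar> \<le> (t + f t * f' t) / K"
proof -
  have mvt: "\<exists>s. 0 < s \<and> s < t \<and> f t = t * f' s" if t: "t \<in> {0<..\<delta>}" for t
  proof -
    have "\<exists>l z. 0 < z \<and> z < t \<and> DERIV f z :> l \<and> f t - f 0 = (t - 0) * l"
    proof (rule MVT)
      show "continuous_on {0..t} f" using t by (auto intro: continuous_on_subset[OF assms(4)])
      show "f differentiable (at z)" if "0 < z" "z < t" for z
        using der[of z] that t by (auto simp: real_differentiable_def)
    qed (use t in auto)
    then obtain l z where z: "0 < z" "z < t" "DERIV f z :> l" "f t = t * l"
      using assms(3) by auto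
    then have "l = f' z" using der[of z] t by (auto intro: DERIV_unique)
    with z show ?thesis by auto
  qed
  obtain \<xi> where \<xi>: "0 < \<xi>" "\<xi> < \<delta>" "f \<delta> = \<delta> * f' \<xi>" using mvt[of \<delta>] assms(1) by auto
  have "f' \<xi> > 0" using pos[of \<delta>] \<xi> assms(1) by (simp add: zero_less_mult_iff)
  then have f'pos: "f' t > 0" if "t \<in> {0<..\<xi>}" for t
    using dec[of t \<xi>] that \<xi> by auto
  have tangent: "t \<le> f t / f' t" if t: "t \<in> {0<..\<xi>}" for t
  proof -
    obtain s where s: "0 < s" "s < t" "f t = t * f' s" using mvt[of t] t \<xi> by auto
    have "t * f' t \<le> f t" using s dec[of s t] t \<xi> by auto
    then show ?thesis using f'pos[OF t] by (simp add: pos_le_divide_eq)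
  qed
  have "\<exists>\<eta>. 0 < \<eta> \<and> \<eta> \<le> \<xi> \<and> (\<forall>t\<in>{0<..\<eta>}. f t / f' t - t \<le> (t + f t * f' t) / K)"
  proof (cases "\<exists>\<eta>\<in>{0<..\<xi>}. (f' \<eta>)\<^sup>2 \<ge> K")
    case True
    then obtain \<eta> where \<eta>: "0 < \<eta>" "\<eta> \<le> \<xi>" "K \<le> (f' \<eta>)\<^sup>2" by auto
    have "f t / f' t - t \<le> (t + f t * f' t) / K" if t: "t \<in> {0<..\<eta>}" for t
    proof -
      have "f' \<eta> \<le> f' t" "f' \<eta> > 0" "f' t > 0" "f t > 0"
        using dec[of t \<eta>] f'pos[of \<eta>] f'pos[of t] pos[of t] t \<eta> \<xi> by auto
      then have "K \<le> (f' t)\<^sup>2" using \<eta>(3) power_mono[of "f' \<eta>" "f' t" 2] by linarith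
      then have "f t * K \<le> f t * (f' t)\<^sup>2" using \<open>f t > 0\<close> by simp
      then have "f t / f' t \<le> f t * f' t / K"
        using \<open>f' t > 0\<close> assms(2) by (simp add: field_simps power2_eq_square)
      moreover have "0 \<le> t / K" using t assms(2) by simp
      ultimately show ?thesis using t by (simp add: add_divide_distrib)
    qed
    then show ?thesis using \<eta> by blast
  next
    case False
    \<comment> \<open>A decreasing bounded \<open>f'\<close> has its supremum \<open>L\<close> as limit at \<open>0\<close>.\<close>
    define L where "L = (SUP s\<in>{0<..\<xi>}. f' s)"
    have "f' s \<le> sqrt K" if "s \<in> {0<..\<xi>}" for s
    proof (rule real_le_rsqrt)
      have "\<not> K \<le> (f' s)\<^sup>2" using False that by blast
      then show "(f' s)\<^sup>2 \<le> K" by simp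
    qed
    then have bdd: "bdd_above (f' ` {0<..\<xi>})" by (auto intro: bdd_aboveI[of _ "sqrt K"])
    have up: "f' s \<le> L" if "s \<in> {0<..\<xi>}" for s
      unfolding L_def by (rule cSUP_upper[OF that bdd])
    have L: "L > 0" using up[of \<xi>] f'pos[of \<xi>] \<xi> by auto
    have "L / (1 + 1 / K) < L" using L assms(2) by (simp add: field_simps)
    then obtain \<eta> where \<eta>: "0 < \<eta>" "\<eta> \<le> \<xi>" "L / (1 + 1 / K) < f' \<eta>"
      unfolding L_def using less_cSUP_iff[OF _ bdd] \<xi>(1) by auto
    have "f t / f' t - t \<le> (t + f t * f' t) / K" if t: "t \<in> {0<..\<eta>}" for t
    proof -
      have f't: "f' \<eta> \<le> f' t" "f' t > 0" "f t > 0"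
        using dec[of t \<eta>] f'pos[of t] pos[of t] t \<eta> \<xi> by auto
      obtain s where s: "0 < s" "s < t" "f t = t * f' s" using mvt[of t] t \<eta> \<xi> by auto
      have "L / (1 + 1 / K) \<le> f' t" using \<eta>(3) f't(1) by linarith
      then have "L \<le> (1 + 1 / K) * f' t" using assms(2)
        by (subst (asm) pos_divide_le_eq) (auto simp: mult.commute add_pos_pos)
      then have "f' s \<le> (1 + 1 / K) * f' t" using up[of s] s t \<eta> by auto
      then have "f t \<le> t * ((1 + 1 / K) * f' t)" using s t by simp
      then have "f t / f' t \<le> t * (1 + 1 / K)"
        using f't(2) by (simp add: pos_divide_le_eq mult.assoc)
      moreover have "0 \<le> f t * f' t / K" using f't assms(2) by simp
      ultimately show ?thesis by (simp add: add_divide_distrib distrib_left)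
    qed
    then show ?thesis using \<eta> by blast
  qed
  then obtain \<eta> where \<eta>: "0 < \<eta>" "\<eta> \<le> \<xi>"
    "\<And>t. t \<in> {0<..\<eta>} \<Longrightarrow> f t / f' t - t \<le> (t + f t * f' t) / K" by blast
  show thesis
  proof (rule that[of \<eta>])
    show "\<bar>t - f t / f' t\<bar> \<le> (t + f t * f' t) / K" if "t \<in> {0<..\<eta>}" for t
      using \<eta>(3)[OF that] tangent[of t] that \<eta> by auto
  qed (use \<eta> \<xi> f'pos in auto)
qed

section \<open>Superlinear decrease\<close>

theorem lemma5p5:
  fixes f :: "real \<Rightarrow> real" and \<epsilon>1 \<epsilon>2 \<epsilon>3 :: real
    and P :: "(real \<times> real) set \<Rightarrow> real \<times> real \<Rightarrow> real \<times> real"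
    and A B :: "(real \<times> real) set"
  assumes "proj_selector P"
    and "basic_conditions f \<epsilon>1 \<epsilon>2 \<epsilon>3"
    and "A = graph_of f" and "B = x_axis"
    and "\<forall>t\<in>{0<..\<epsilon>3}. deriv (deriv f) t < 0"
  shows "\<forall>K::real. K > 0 \<longrightarrow>
    (\<exists>\<epsilon>K>0. \<forall>x\<in>{0<..\<epsilon>K}.
       norm (C_T P A B (x, 0)) / norm (x, 0::real) \<le> 1 / K)"
proof (intro allI impI)
  fix K :: real assume K: "K > 0"
  interpret basic_conditions f \<epsilon>1 \<epsilon>2 \<epsilon>3 by (rule assms(2))
  define \<delta> where "\<delta> = min \<epsilon>1 \<epsilon>3"
  have \<delta>: "\<delta> > 0" "\<delta> \<le> \<epsilon>1" "\<delta> \<le> \<epsilon>3" using eps_pos by (auto simp: \<delta>_def)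
  have f0: "f 0 = 0" using B2 eps_pos by auto
  have der: "(f has_real_derivative deriv f t) (at t)" if "t \<in> {0<..\<delta>}" for t
  proof -
    have "f differentiable (at t)" using B5(1) that \<delta> by auto
    then show ?thesis by (simp add: DERIV_deriv_iff_real_differentiable)
  qed
  have dec: "deriv f t \<le> deriv f s" if st: "0 < s" "s \<le> t" "t \<le> \<delta>" for s t
  proof (rule DERIV_nonpos_imp_nonincreasing[OF st(2)])
    fix r assume r: "s \<le> r" "r \<le> t"
    have "deriv f differentiable (at r)" using B5(3) r st \<delta> by auto
    then have "(deriv f has_real_derivative deriv (deriv f) r) (at r)"
      by (simp add: DERIV_deriv_iff_real_differentiable)
    moreover have "deriv (deriv f) r \<le> 0" using assms(5) r st \<delta> by (auto intro: less_imp_le)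
    ultimately show "\<exists>y. (deriv f has_real_derivative y) (at r) \<and> y \<le> 0" by blast
  qed
  have pos: "f t > 0" if "t \<in> {0<..\<delta>}" for t using B6 that \<delta> by auto
  have "continuous_on {0..\<delta>} f" using B1(1) by (rule continuous_on_subset) auto
  from newton_error_concave[OF \<delta>(1) K f0 this der dec pos]
  obtain \<eta> where \<eta>: "0 < \<eta>" "\<eta> \<le> \<delta>" and f'pos: "\<And>t. t \<in> {0<..\<eta>} \<Longrightarrow> deriv f t > 0"
    and err: "\<And>t. t \<in> {0<..\<eta>} \<Longrightarrow> \<bar>t - f t / deriv f t\<bar> \<le> (t + f t * deriv f t) / K"
    by blast
  have "norm (C_T P A B (x, 0)) / norm (x, 0::real) \<le> 1 / K" if x: "x \<in> {0<..\<eta> / 2}" for x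
  proof -
    have "graph_of f \<noteq> {}" by (auto simp: graph_of_def)
    then have PA: "P A (x, 0) \<in> proj_set (graph_of f) (x, 0)"
      using assms(1,3) closed_graph_of[OF B1(1)] by (auto simp: proj_selector_def)
    then obtain t where t: "P A (x, 0) = (t, f t)" by (auto simp: proj_set_def graph_of_def)
    have range: "0 \<le> t" "t \<le> 2 * x" using proj_graph_range[of t f x] PA t f0 x by auto
    show ?thesis
    proof (cases "t = 0")
      case True
      then show ?thesis using C_T_axis_eq_0[OF assms(1), of A x] t f0 K assms(4) by simp
    next
      case False
      then have t\<eta>: "t \<in> {0<..\<eta>}" using range x by auto
      then have ft: "f t > 0" and f't: "deriv f t > 0" using pos \<eta> f'pos by auto
      have crit: "x - t = f t * deriv f t"
        using proj_graph_critical[of t f x] PA t der[of t] t\<eta> \<eta> by auto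
      then have "t \<noteq> x" using ft f't by auto
      then have "C_T P A B (x, 0) = (t - (f t)\<^sup>2 / (x - t), 0)"
        using C_T_axis[OF assms(1) t] ft assms(4) by simp
      also have "(f t)\<^sup>2 / (x - t) = f t / deriv f t"
        using ft f't by (simp add: crit power2_eq_square)
      finally have "norm (C_T P A B (x, 0)) = \<bar>t - f t / deriv f t\<bar>" by (simp add: norm_Pair)
      also have "\<dots> \<le> x / K" using err[OF t\<eta>] crit by (simp add: algebra_simps)
      finally show ?thesis using x K by (simp add: norm_Pair field_simps)
    qed
  qed
  then show "\<exists>\<epsilon>K>0. \<forall>x\<in>{0<..\<epsilon>K}. norm (C_T P A B (x, 0)) / norm (x, 0::real) \<le> 1 / K"
    using \<eta>(1) by (intro exI[of _ "\<eta> / 2"]) auto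
qed

end
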